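(* Let $F$ be a field. Then $(\mathbb{N},\vee,\wedge)$ is a commutative semiring, where $\vee$ (the addition) is the maximum of two integers and $\wedge$ (the multiplication) is the operation on $\mathbb{N}$ attached to $F$ defined in the context.
   Context: $\mathbb{N}=\{0,1,2,\dots\}$. For positive integers $i,j$, $i\wedge j$ is the maximum value of $r+s+1$ over integers $0\le r\le i-1$, $0\le s\le j-1$ such that $\binom{r+s}{r}\ne0$ in $F$; and $0\wedge n=n\wedge0=0$ for all $n\in\mathbb{N}$. A commutative semiring is a set $S$ with two associative operations $+,\cdot$ such that $(S,+)$ is a commutative monoid with neutral element $0$, $0\cdot a=0$ for all $a$, $(S,\cdot)$ is a commutative monoid with neutral element $1\ne0$, and $\cdot$ distributes over $+$. *)

theory Defs
  imports Complex_Main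
begin

text \<open>The field enters only through the vanishing of integers in it, so it is passed as a type.
  For positive \<open>i\<close> and \<open>j\<close> the set below is finite and contains 1 (take \<open>r = s = 0\<close>), so that
  \<open>Max\<close> is meaningful, and the natural-number subtractions do not truncate.\<close>

definition wedge :: "'a::field itself \<Rightarrow> nat \<Rightarrow> nat \<Rightarrow> nat" where
  "wedge F i j =
     (if i = 0 \<or> j = 0 then 0
      else Max {r + s + 1 | r s. r \<le> i - 1 \<and> s \<le> j - 1 \<and>
                                 of_nat ((r + s) choose r) \<noteq> (0 :: 'a)})"

end

theory Submission
  imports Defs
begin

text \<open>By Pascal's rule a nonzero \<open>binom(r+s, r)\<close> forces \<open>binom(r+s-1, r-1)\<close> or \<open>binom(r+s-1, r)\<close>
  to be nonzero, so the values \<open>r + s\<close> over which the maximum is taken form an initial segment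
  of the naturals. Hence \<open>u < i \<and> j\<close> holds iff \<open>u\<close> itself is such a sum, and the semiring laws
  become statements about representable sums. Associativity holds because \<open>u < (i \<and> j) \<and> k\<close> and
  \<open>u < i \<and> (j \<and> k)\<close> both say that \<open>u = r + s + t\<close> for some \<open>r < i\<close>, \<open>s < j\<close>, \<open>t < k\<close> with nonzero
  multinomial coefficient.\<close>

lemma nonzero_binomial_pred:
  assumes "of_nat ((r + s) choose r) \<noteq> (0 :: 'a::semiring_1)" and "r + s = Suc n"
  obtains r' s' where "r' \<le> r" "s' \<le> s" "r' + s' = n" "of_nat ((r' + s') choose r') \<noteq> (0 :: 'a)"
proof (cases r)
  case 0
  show ?thesis
    using 0 assms by (intro that[of 0 n]) auto
next
  case (Suc q)
  \<comment> \<open>Pascal's rule for \<open>Suc n choose Suc q\<close>.\<close>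
  have split: "(of_nat (n choose q) :: 'a) + of_nat (n choose Suc q) \<noteq> 0"
    using assms Suc by (simp flip: of_nat_add)
  show ?thesis
  proof (cases "of_nat (n choose q) = (0 :: 'a)")
    case True
    then have nz: "of_nat (n choose Suc q) \<noteq> (0 :: 'a)"
      using split by simp
    \<comment> \<open>Thus \<open>n - r\<close> does not truncate: it is \<open>s - 1\<close>, so
      the pair sums to \<open>n\<close>.\<close>
    then have "Suc q \<le> n"
      by (metis binomial_eq_0 not_le of_nat_0)
    then show ?thesis
      using nz assms(2) Suc by (intro that[of r "n - r"]) auto
  next
    case False
    then show ?thesis
      using assms(2) Suc by (intro that[of q s]) auto
  qed
qed

text \<open>Iterates the predecessor step. As neither index grows, the new pair stays within the
  bounds that define \<open>wedge\<close>.\<close>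

lemma nonzero_binomial_descend:
  assumes "of_nat ((r + s) choose r) \<noteq> (0 :: 'a::semiring_1)" and "u \<le> r + s"
  shows "\<exists>r' \<le> r. \<exists>s' \<le> s. u = r' + s' \<and> of_nat ((r' + s') choose r') \<noteq> (0 :: 'a)"
  using assms
proof (induction "r + s" arbitrary: r s)
  case 0
  then show ?case by auto
next
  case (Suc n)
  show ?case
  proof (cases "u = r + s")
    case True
    then show ?thesis using Suc.prems by auto
  next
    case False
    obtain r' s' where "r' \<le> r" "s' \<le> s" "r' + s' = n"
      "of_nat ((r' + s') choose r') \<noteq> (0 :: 'a)"
      using nonzero_binomial_pred[OF Suc.prems(1) Suc.hyps(2)[symmetric]] .
    moreover from this have "u \<le> r' + s'"
      using False Suc.prems(2) Suc.hyps(2) by linarith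
    ultimately show ?thesis
      using Suc.hyps(1)[of r' s'] le_trans by blast
  qed
qed

text \<open>Strict inequality absorbs the \<open>+ 1\<close> and also covers \<open>i = 0\<close> or
  \<open>j = 0\<close>, where both sides are false.\<close>

lemma less_wedge_iff:
  fixes F :: "'a::field itself"
  shows "u < wedge F i j \<longleftrightarrow>
    (\<exists>r s. r < i \<and> s < j \<and> u = r + s \<and> of_nat ((r + s) choose r) \<noteq> (0 :: 'a))"
proof (cases "i = 0 \<or> j = 0")
  case True
  then show ?thesis by (auto simp: wedge_def)
next
  case False
  define A where "A = {r + s + 1 | r s. r \<le> i - 1 \<and> s \<le> j - 1 \<and>
                                 of_nat ((r + s) choose r) \<noteq> (0 :: 'a)}"
  have A: "x \<in> A \<longleftrightarrow> (\<exists>r s. r < i \<and> s < j \<and> x = Suc (r + s) \<and>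
      of_nat ((r + s) choose r) \<noteq> (0 :: 'a))" for x
  proof -
    have "r \<le> i - 1 \<longleftrightarrow> r < i" "s \<le> j - 1 \<longleftrightarrow> s < j" for r s
      using False by auto
    then show ?thesis
      unfolding A_def by auto
  qed
  have "A \<subseteq> {..i + j}"
    by (auto simp: A)
  then have "finite A"
    using finite_subset by blast
  moreover have "1 \<in> A"
    using False unfolding A by (intro exI[of _ 0]) auto
  ultimately have "u < Max A \<longleftrightarrow> (\<exists>x\<in>A. u < x)"
    by (intro Max_gr_iff) auto
  also have "\<dots> \<longleftrightarrow> (\<exists>r s. r < i \<and> s < j \<and> u \<le> r + s \<and> of_nat ((r + s) choose r) \<noteq> (0 :: 'a))"
    unfolding A Bex_def less_Suc_eq_le[symmetric] by blast
  \<comment> \<open>Descent sharpens the bound \<open>u \<le> r + s\<close> to an equality.\<close>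
  also have "\<dots> \<longleftrightarrow> (\<exists>r s. r < i \<and> s < j \<and> u = r + s \<and> of_nat ((r + s) choose r) \<noteq> (0 :: 'a))"
    (is "?L \<longleftrightarrow> ?R")
  proof
    assume ?L
    then obtain r s where "r < i" "s < j" "u \<le> r + s" "of_nat ((r + s) choose r) \<noteq> (0 :: 'a)"
      by blast
    then show ?R
      using nonzero_binomial_descend[of r s u] le_less_trans by blast
  next
    assume ?R
    then show ?L by blast
  qed
  finally show ?thesis
    using False by (simp add: wedge_def A_def)
qed

lemma nat_eqI_less: "(\<And>u. u < a \<longleftrightarrow> u < b) \<Longrightarrow> a = b" for a b :: nat
  by (metis linorder_neqE_nat less_irrefl)

lemma wedge_commute: "wedge F i j = wedge F j i"
proof -
  have "(r + s) choose r = (s + r) choose s" for r s :: nat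
    using binomial_symmetric[of r "r + s"] by (simp add: add.commute)
  then show ?thesis
    by (intro nat_eqI_less) (metis less_wedge_iff add.commute)
qed

text \<open>Here \<open>r = 0\<close>, and \<open>s choose 0 = 1\<close> is nonzero for every
  \<open>s < j\<close>.\<close>

lemma one_wedge: "wedge F 1 j = j"
  by (intro nat_eqI_less) (auto simp: less_wedge_iff)

text \<open>\<open>r < max i j\<close> is a disjunction, over which the existential quantifiers
  distribute.\<close>

lemma max_wedge_distrib: "wedge F (max i j) k = max (wedge F i k) (wedge F j k)"
  by (intro nat_eqI_less) (auto simp: less_wedge_iff less_max_iff_disj)

lemma wedge_assoc:
  fixes F :: "'a::field itself"
  shows "wedge F (wedge F i j) k = wedge F i (wedge F j k)"
proof (intro nat_eqI_less)
  fix u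
  have *: "of_nat ((r + s) choose r) \<noteq> (0 :: 'a) \<and> of_nat ((r + s + t) choose (r + s)) \<noteq> (0 :: 'a) \<longleftrightarrow>
      of_nat ((s + t) choose s) \<noteq> (0 :: 'a) \<and> of_nat ((r + (s + t)) choose r) \<noteq> (0 :: 'a)" for r s t
  proof -
    \<comment> \<open>Both products are the multinomial coefficient of \<open>r, s, t\<close>. Since
      a field has no zero divisors, its image is nonzero iff both factors' images are.\<close>
    have "((r + s + t) choose (r + s)) * ((r + s) choose r) =
        ((r + (s + t)) choose r) * ((s + t) choose s)"
      using choose_mult_lemma[of s t r] by (simp add: ac_simps)
    then have "(of_nat ((r + s + t) choose (r + s)) * of_nat ((r + s) choose r) :: 'a) =
        of_nat ((r + (s + t)) choose r) * of_nat ((s + t) choose s)"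
      by (metis of_nat_mult)
    then show ?thesis
      by (metis mult_eq_0_iff)
  qed
  have "u < wedge F (wedge F i j) k \<longleftrightarrow> (\<exists>r s t. r < i \<and> s < j \<and> t < k \<and> u = r + s + t \<and>
      of_nat ((r + s) choose r) \<noteq> (0 :: 'a) \<and> of_nat ((r + s + t) choose (r + s)) \<noteq> (0 :: 'a))"
    unfolding less_wedge_iff by blast
  also have "\<dots> \<longleftrightarrow> (\<exists>r s t. r < i \<and> s < j \<and> t < k \<and> u = r + (s + t) \<and>
      of_nat ((s + t) choose s) \<noteq> (0 :: 'a) \<and> of_nat ((r + (s + t)) choose r) \<noteq> (0 :: 'a))"
    by (intro ex_cong1) (use * in \<open>auto simp: add.assoc\<close>)
  also have "\<dots> \<longleftrightarrow> u < wedge F i (wedge F j k)"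
    unfolding less_wedge_iff by blast
  finally show "u < wedge F (wedge F i j) k \<longleftrightarrow> u < wedge F i (wedge F j k)" .
qed

theorem theorem2p3:
  fixes F :: "'a::field itself"
  shows "class.comm_semiring_1 (wedge F) (1 :: nat) max 0"
proof
  fix i j k
  show "wedge F (wedge F i j) k = wedge F i (wedge F j k)"
    by (rule wedge_assoc)
  show "wedge F i j = wedge F j i"
    by (rule wedge_commute)
  show "wedge F 1 i = i"
    by (rule one_wedge)
  show "wedge F (max i j) k = max (wedge F i k) (wedge F j k)"
    by (rule max_wedge_distrib)
  show "wedge F 0 i = 0" "wedge F i 0 = 0"
    by (simp_all add: wedge_def)
\<comment> \<open>What remains are the monoid laws of \<open>max\<close> with 0 and
  \<open>0 \<noteq> 1\<close>.\<close>
qed simp_all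

end
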